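(* Let $k\ge 1$ be an integer, let $S^1\subset\mathbb{R}^2$ be the unit circle, and let $f:S^1\to S^1$ be a $C^k$ diffeomorphism. Then there exists a $C^k$ symplectomorphism $\varphi:\mathbb{R}^2\to\mathbb{R}^2$ such that $\varphi|_{S^1}=f$.
   Context: $\mathbb{R}^2$ carries the standard symplectic form $dx\wedge dy$. A $C^k$ symplectomorphism $\varphi:\mathbb{R}^2\to\mathbb{R}^2$ is a $C^k$ diffeomorphism with $\varphi^*(dx\wedge dy)=dx\wedge dy$.
   Formalization: The diffeomorphism f is additionally assumed to preserve the orientation of the circle; this is necessary, since for example f(x,y) = (x,−y) has no symplectic extension to the plane. *)

theory Defs
  imports "HOL-Analysis.Analysis"
begin

text \<open>On an open set of a Euclidean space, \<open>C\<^sup>0\<close> means continuous and \<open>C\<^sup>n\<^sup>+\<^sup>1\<close> means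
  differentiable with all directional derivatives of class \<open>C\<^sup>n\<close>. Since the dimension is finite,
  this is equivalent to the total derivative being \<open>C\<^sup>n\<close> as an operator-valued map.\<close>

primrec Ck_open :: "nat \<Rightarrow> 'a set \<Rightarrow> ('a::euclidean_space \<Rightarrow> 'b::euclidean_space) \<Rightarrow> bool" where
  "Ck_open 0 U f \<longleftrightarrow> continuous_on U f"
| "Ck_open (Suc n) U f \<longleftrightarrow>
     (\<forall>x\<in>U. f differentiable (at x)) \<and>
     (\<forall>v. Ck_open n U (\<lambda>x. frechet_derivative f (at x) v))"

text \<open>A map defined on an arbitrary subset (such as an embedded submanifold) is \<open>C\<^sup>k\<close> if near each
  point of the subset it is the restriction of a \<open>C\<^sup>k\<close> map on an open set of the ambient space.
  For embedded submanifolds this agrees with the definition through charts. Values of \<open>f\<close> outside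
  \<open>A\<close> are irrelevant.\<close>

definition Ck_on :: "nat \<Rightarrow> 'a set \<Rightarrow> ('a::euclidean_space \<Rightarrow> 'b::euclidean_space) \<Rightarrow> bool" where
  "Ck_on k A f \<longleftrightarrow>
     (\<forall>x\<in>A. \<exists>U g. open U \<and> x \<in> U \<and> Ck_open k U g \<and> (\<forall>y\<in>A \<inter> U. g y = f y))"

definition Ck_diffeo ::
    "nat \<Rightarrow> 'a set \<Rightarrow> 'b set \<Rightarrow> ('a::euclidean_space \<Rightarrow> 'b::euclidean_space) \<Rightarrow> bool" where
  "Ck_diffeo k A B f \<longleftrightarrow> bij_betw f A B \<and> Ck_on k A f \<and> Ck_on k B (inv_into A f)"

type_synonym plane = "real \<times> real"

type_synonym two_form = "plane \<Rightarrow> plane \<Rightarrow> plane \<Rightarrow> real"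

definition dx_wedge_dy :: two_form where
  "dx_wedge_dy p u v = fst u * snd v - snd u * fst v"

definition pullback :: "(plane \<Rightarrow> plane) \<Rightarrow> two_form \<Rightarrow> two_form" where
  "pullback \<phi> \<omega> p u v =
     \<omega> (\<phi> p) (frechet_derivative \<phi> (at p) u) (frechet_derivative \<phi> (at p) v)"

text \<open>For \<open>k = 0\<close> the derivative in \<open>pullback\<close> need not exist, so this is meaningful only
  for \<open>k \<ge> 1\<close>.\<close>

definition Ck_symplectomorphism :: "nat \<Rightarrow> (plane \<Rightarrow> plane) \<Rightarrow> bool" where
  "Ck_symplectomorphism k \<phi> \<longleftrightarrow>
     Ck_diffeo k UNIV UNIV \<phi> \<and> pullback \<phi> dx_wedge_dy = dx_wedge_dy"

abbreviation unit_circle :: "plane set" where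
  "unit_circle \<equiv> sphere 0 1"

text \<open>The tangent line of the circle at \<open>q = (a, b)\<close> is oriented counterclockwise, i.e. by the
  vector \<open>(- b, a)\<close>. A diffeomorphism of the circle preserves orientation if its differential
  maps the positive unit tangent vector at each point, which is the velocity of
  \<open>t \<mapsto> (cos t, sin t)\<close>, to a positive multiple of the positive unit tangent vector at the image
  point. Restrictions of symplectomorphisms of the plane to the circle that map it onto itself
  necessarily have this property, because they preserve the orientation of the plane and map the
  disc to itself.\<close>

definition circle_orientation_preserving :: "(plane \<Rightarrow> plane) \<Rightarrow> bool" where
  "circle_orientation_preserving f \<longleftrightarrow>
     (\<forall>t. let q = f (cos t, sin t) in
        vector_derivative (\<lambda>s. f (cos s, sin s)) (at t) \<bullet> (- snd q, fst q) > 0)"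

end

theory Submission
  imports Defs
begin

text \<open>Lift \<open>f\<close> to an increasing \<open>F\<close> on the line with \<open>F (t + 2\<pi>) = F t + 2\<pi>\<close>, and use the
  symplectic polar coordinates \<open>(t, J)\<close>, \<open>J = (r\<^sup>2 - 1) / 2\<close>. The obvious symplectic extension
  \<open>(t, J) \<mapsto> (F t, J / F' t)\<close> loses a derivative. Instead take the mixed-variable generating function
  \<open>S(t, J) = t J + 1/2 \<integral> (F u - u) du\<close> over \<open>[t - w J, t + w J]\<close>, which defines the map
  \<open>(t, \<partial>\<^sub>t S) \<mapsto> (\<partial>\<^sub>J S, J)\<close>. Averaging over an interval of length proportional to the distance
  from \<open>J = 0\<close> makes both first partial derivatives \<open>C\<^sup>k\<close>. If \<open>w 0 = 0\<close> and \<open>w' 0 = 1\<close> the map restricts to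
  \<open>F\<close> on \<open>J = 0\<close>. If moreover \<open>w\<close> has compact support and \<open>- 1 / max F' \<le> w' \<le> 1\<close>, then the mixed derivative
  of \<open>S\<close> is positive everywhere and the map is the identity away from \<open>J = 0\<close>, so it descends to the plane.\<close>

section \<open>The calculus of \<open>C\<^sup>k\<close> maps\<close>

text \<open>Openness turns equality on \<open>U\<close> into equality near each point of
  \<open>U\<close>, so the derivatives agree as well and the induction can pass to them.\<close>

lemma Ck_open_cong:
  assumes "open U" "\<And>x. x \<in> U \<Longrightarrow> f x = g x" "Ck_open n U f"
  shows "Ck_open n U g"
  using assms(2,3)
proof (induction n arbitrary: f g)
  case 0
  then show ?case by (simp cong: continuous_on_cong)
next
  case (Suc n)
  have tr: "(g has_derivative D) (at x)" if "(f has_derivative D) (at x)" "x \<in> U" for x D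
    using has_derivative_transform_within_open[OF that(1) assms(1) that(2)] Suc.prems(1) by blast
  have eq: "frechet_derivative f (at x) = frechet_derivative g (at x)" if "x \<in> U" for x
    using tr[OF _ that] Suc.prems(2) that
    by (metis Ck_open.simps(2) frechet_derivative_at frechet_derivative_works)
  show ?case
    using Suc.prems(2) tr eq Suc.IH[of "\<lambda>x. frechet_derivative f (at x) v" "\<lambda>x. frechet_derivative g (at x) v" for v]
    by (fastforce simp: differentiable_def)
qed

lemma Ck_open_subset: "Ck_open n U f \<Longrightarrow> V \<subseteq> U \<Longrightarrow> Ck_open n V f"
  by (induction n arbitrary: f) (auto intro: continuous_on_subset)

lemma Ck_open_Suc_imp: "Ck_open (Suc n) U f \<Longrightarrow> Ck_open n U f"
proof (induction n arbitrary: f)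
  case 0
  then show ?case
    by (auto intro!: continuous_at_imp_continuous_on differentiable_imp_continuous_within)
next
  case (Suc n)
  have "Ck_open n U (\<lambda>x. frechet_derivative f (at x) v)" for v
    using Suc.prems by (intro Suc.IH) simp
  then show ?case using Suc.prems by simp
qed

lemma Ck_open_has_derivative:
  "Ck_open (Suc n) U f \<Longrightarrow> x \<in> U \<Longrightarrow> (f has_derivative frechet_derivative f (at x)) (at x)"
  by (simp add: frechet_derivative_works)

lemma Ck_open_frechet_derivative:
  "Ck_open (Suc n) U f \<Longrightarrow> Ck_open n U (\<lambda>x. frechet_derivative f (at x) v)"
  by simp

declare Ck_open.simps(2) [simp del]

lemma Ck_open_le: "m \<le> n \<Longrightarrow> Ck_open n U f \<Longrightarrow> Ck_open m U f"
  by (induction n) (auto simp: le_Suc_eq dest: Ck_open_Suc_imp)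

lemma Ck_open_imp_continuous_on: "Ck_open n U f \<Longrightarrow> continuous_on U f"
  using Ck_open_le[of 0 n U f] by simp

lemma Ck_open_differentiable:
  "Ck_open n U f \<Longrightarrow> 1 \<le> n \<Longrightarrow> x \<in> U \<Longrightarrow> f differentiable (at x)"
  by (cases n) (auto simp: Ck_open.simps(2))

text \<open>Serves maps known only through local formulas: the circle map through its local
  extensions, the descended map through local branches of the angle.\<close>

lemma Ck_open_locally:
  assumes "\<And>x. x \<in> U \<Longrightarrow> \<exists>V. open V \<and> x \<in> V \<and> Ck_open n V f"
  shows "Ck_open n U f"
  using assms
proof (induction n arbitrary: f)
  case 0
  then show ?case
    by (metis Ck_open.simps(1) continuous_at_imp_continuous_on continuous_on_eq_continuous_at)
next
  case (Suc n)
  then show ?case by (fastforce simp: Ck_open.simps(2))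
qed

text \<open>By uniqueness of derivatives on an open set, any explicit formula \<open>f'\<close> may
  stand in for \<open>frechet_derivative\<close>. This is the working introduction rule for the
  inductive step.\<close>

lemma Ck_open_SucI:
  assumes "open U" "\<And>x. x \<in> U \<Longrightarrow> (f has_derivative f' x) (at x)"
    and "\<And>v. Ck_open n U (\<lambda>x. f' x v)"
  shows "Ck_open (Suc n) U f"
proof -
  have "Ck_open n U (\<lambda>x. frechet_derivative f (at x) v)" for v
    by (rule Ck_open_cong[OF assms(1) _ assms(3)[of v]]) (metis assms(2) frechet_derivative_at)
  then show ?thesis using assms(2) by (auto simp: differentiable_def Ck_open.simps(2))
qed

section \<open>Closure under algebraic operations and composition\<close>

lemma Ck_open_const: "open U \<Longrightarrow> Ck_open n U (\<lambda>x. c)"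
proof (induction n arbitrary: c)
  case (Suc n)
  show ?case
    by (rule Ck_open_SucI[where f' = "\<lambda>x v. 0"]) (use Suc in auto)
qed simp

lemma Ck_open_bounded_linear:
  assumes "open U" "bounded_linear f"
  shows "Ck_open n U f"
proof (cases n)
  case 0
  then show ?thesis using linear_continuous_on[OF assms(2)] by simp
next
  case (Suc m)
  show ?thesis unfolding Suc
    by (rule Ck_open_SucI[where f' = "\<lambda>x v. f v"])
      (use assms bounded_linear_imp_has_derivative Ck_open_const in auto)
qed

lemma Ck_open_linear_compose:
  assumes "open U" "bounded_linear l" "Ck_open n U f"
  shows "Ck_open n U (\<lambda>x. l (f x))"
  using assms(3)
proof (induction n arbitrary: f)
  case 0
  then show ?case
    using bounded_linear.continuous_on[OF assms(2)] by simp
next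
  case (Suc n)
  show ?case
    by (rule Ck_open_SucI[OF assms(1) bounded_linear.has_derivative[OF assms(2)
          Ck_open_has_derivative[OF Suc.prems]] Suc.IH[OF Ck_open_frechet_derivative[OF Suc.prems]]])
qed

lemma Ck_open_add:
  assumes "open U" "Ck_open n U f" "Ck_open n U g"
  shows "Ck_open n U (\<lambda>x. f x + g x)"
  using assms(2,3)
proof (induction n arbitrary: f g)
  case 0
  then show ?case by (simp add: continuous_on_add)
next
  case (Suc n)
  show ?case
    by (rule Ck_open_SucI[OF assms(1) has_derivative_add[OF Ck_open_has_derivative[OF Suc.prems(1)]
          Ck_open_has_derivative[OF Suc.prems(2)]] Suc.IH[OF Ck_open_frechet_derivative[OF Suc.prems(1)]
          Ck_open_frechet_derivative[OF Suc.prems(2)]]])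
qed

lemma Ck_open_sum:
  assumes "open U" "finite I" "\<And>i. i \<in> I \<Longrightarrow> Ck_open n U (f i)"
  shows "Ck_open n U (\<lambda>x. \<Sum>i\<in>I. f i x)"
  using assms(2,3)
  by (induction I rule: finite_induct) (auto intro: Ck_open_const Ck_open_add assms(1))

text \<open>The product rule gives a sum of two terms of the same shape, each with one factor
  differentiated, so the induction closes. Scaling and multiplication are instances.\<close>

lemma Ck_open_bilinear:
  assumes "open U" "bounded_bilinear h" "Ck_open n U f" "Ck_open n U g"
  shows "Ck_open n U (\<lambda>x. h (f x) (g x))"
  using assms(3,4)
proof (induction n arbitrary: f g)
  case 0
  then show ?case using bounded_bilinear.continuous_on[OF assms(2)] by simp
next
  case (Suc n)
  have "Ck_open n U (\<lambda>x. h (f x) (frechet_derivative g (at x) v) + h (frechet_derivative f (at x) v) (g x))"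
    for v
    using Suc.prems
    by (intro Ck_open_add Suc.IH assms(1) Ck_open_frechet_derivative) (auto intro: Ck_open_Suc_imp)
  from Ck_open_SucI[OF assms(1) bounded_bilinear.FDERIV[OF assms(2)
      Ck_open_has_derivative[OF Suc.prems(1)] Ck_open_has_derivative[OF Suc.prems(2)]] this]
  show ?case .
qed

lemmas Ck_open_scaleR = Ck_open_bilinear[OF _ bounded_bilinear_scaleR]
lemmas Ck_open_mult = Ck_open_bilinear[OF _ bounded_bilinear_mult]

lemma Ck_open_uminus: "open U \<Longrightarrow> Ck_open n U f \<Longrightarrow> Ck_open n U (\<lambda>x. - f x)"
  by (rule Ck_open_linear_compose[OF _ bounded_linear_minus[OF bounded_linear_ident]])

lemma Ck_open_diff:
  "open U \<Longrightarrow> Ck_open n U f \<Longrightarrow> Ck_open n U g \<Longrightarrow> Ck_open n U (\<lambda>x. f x - g x)"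
  using Ck_open_add[of U n f "\<lambda>x. - g x"] Ck_open_uminus[of U n g] by simp

lemma Ck_open_ident: "open U \<Longrightarrow> Ck_open n U (\<lambda>x. x)"
  by (rule Ck_open_bounded_linear) (auto intro: bounded_linear_ident)

lemma Ck_open_fst: "open U \<Longrightarrow> Ck_open n U f \<Longrightarrow> Ck_open n U (\<lambda>x. fst (f x))"
  by (rule Ck_open_linear_compose[OF _ bounded_linear_fst])

lemma Ck_open_snd: "open U \<Longrightarrow> Ck_open n U f \<Longrightarrow> Ck_open n U (\<lambda>x. snd (f x))"
  by (rule Ck_open_linear_compose[OF _ bounded_linear_snd])

lemma Ck_open_Pair:
  assumes "open U" "Ck_open n U f" "Ck_open n U g"
  shows "Ck_open n U (\<lambda>x. (f x, g x))"
proof -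
  have "Ck_open n U (\<lambda>x. (f x, 0) + (0, g x))"
    using assms
    by (intro Ck_open_add Ck_open_linear_compose[where l = "\<lambda>a. (a, 0)"]
        Ck_open_linear_compose[where l = "\<lambda>a. (0, a)"] bounded_linear_Pair bounded_linear_ident bounded_linear_zero)
  then show ?thesis by simp
qed

lemma Ck_open_compose:
  assumes "open U" "open V" "f ` U \<subseteq> V" "Ck_open n V g" "Ck_open n U f"
  shows "Ck_open n U (\<lambda>x. g (f x))"
  using assms(4,5)
proof (induction n arbitrary: g)
  case 0
  then show ?case using assms(3) by (auto intro: continuous_on_compose2)
next
  case (Suc n)
  let ?D = "\<lambda>x v. frechet_derivative f (at x) v"
  let ?E = "\<lambda>y v. frechet_derivative g (at y) v"
  have der: "((\<lambda>x. g (f x)) has_derivative (\<lambda>v. ?E (f x) (?D x v))) (at x)" if "x \<in> U" for x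
    using has_derivative_compose[of f "?D x" x UNIV g "?E (f x)"] that assms(3)
      Ck_open_has_derivative[OF Suc.prems(1)] Ck_open_has_derivative[OF Suc.prems(2)] by blast
  \<comment> \<open>In the chain rule both the base point and the direction of \<open>?E\<close>
    depend on \<open>x\<close>, whereas C^n is known only for fixed directions. Expanding the
    direction in the basis leaves scalar coefficients times derivatives in fixed directions.\<close>
  have exp: "?E (f x) (?D x v) = (\<Sum>b\<in>Basis. (?D x v \<bullet> b) *\<^sub>R ?E (f x) b)" if "x \<in> U" for x v
  proof -
    have "linear (?E (f x))"
      using Ck_open_has_derivative[OF Suc.prems(1)] that assms(3)
      by (blast intro: has_derivative_linear)
    then have "?E (f x) (\<Sum>b\<in>Basis. (?D x v \<bullet> b) *\<^sub>R b) = (\<Sum>b\<in>Basis. (?D x v \<bullet> b) *\<^sub>R ?E (f x) b)"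
      by (simp add: linear_sum linear_scale)
    then show ?thesis by (simp add: euclidean_representation)
  qed
  have "Ck_open n U (\<lambda>x. \<Sum>b\<in>Basis. (?D x v \<bullet> b) *\<^sub>R ?E (f x) b)" for v
    using Suc.prems
    by (intro Ck_open_sum Ck_open_scaleR assms(1) finite_Basis Suc.IH Ck_open_frechet_derivative
        Ck_open_linear_compose[OF assms(1) bounded_linear_inner_left])
      (auto intro: Ck_open_Suc_imp)
  then have "Ck_open n U (\<lambda>x. ?E (f x) (?D x v))" for v
    by (rule Ck_open_cong[OF assms(1), rotated]) (simp add: exp)
  then show ?case by (intro Ck_open_SucI[OF assms(1) der])
qed

section \<open>Regularity of elementary real functions\<close>

lemma Ck_open_real_SucI:
  fixes f :: "real \<Rightarrow> real"
  assumes "open U" "\<And>x. x \<in> U \<Longrightarrow> (f has_real_derivative f' x) (at x)" "Ck_open n U f'"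
  shows "Ck_open (Suc n) U f"
  using assms
  by (intro Ck_open_SucI[where f' = "\<lambda>x v. f' x * v"] Ck_open_mult Ck_open_const)
    (auto simp: has_field_derivative_def)

lemma Ck_open_sin_cos: "Ck_open n UNIV (sin :: real \<Rightarrow> real)" "Ck_open n UNIV (cos :: real \<Rightarrow> real)"
proof (induction n)
  case 0
  show "Ck_open 0 UNIV (sin :: real \<Rightarrow> real)" "Ck_open 0 UNIV (cos :: real \<Rightarrow> real)"
    by (auto intro: continuous_intros)
next
  case (Suc n)
  show "Ck_open (Suc n) UNIV (sin :: real \<Rightarrow> real)"
    using Suc by (intro Ck_open_real_SucI[where f' = cos]) (auto intro: derivative_eq_intros)
  show "Ck_open (Suc n) UNIV (cos :: real \<Rightarrow> real)"
    using Suc Ck_open_uminus[of UNIV n "sin :: real \<Rightarrow> real"]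
    by (intro Ck_open_real_SucI[where f' = "\<lambda>x. - sin x"]) (auto intro: derivative_eq_intros)
qed

lemma Ck_open_real_inverse: "Ck_open n (- {0}) (inverse :: real \<Rightarrow> real)"
proof (induction n)
  case (Suc n)
  show ?case
    using Suc by (intro Ck_open_real_SucI[where f' = "\<lambda>x. - (inverse x * inverse x)"]
      Ck_open_uminus Ck_open_mult) (auto intro!: derivative_eq_intros simp: power2_eq_square)
qed (auto intro!: continuous_intros)

lemma Ck_open_inverse:
  fixes f :: "'a::euclidean_space \<Rightarrow> real"
  assumes "open U" "Ck_open n U f" "\<And>x. x \<in> U \<Longrightarrow> f x \<noteq> 0"
  shows "Ck_open n U (\<lambda>x. inverse (f x))"
  by (rule Ck_open_compose[OF assms(1) _ _ Ck_open_real_inverse assms(2)]) (use assms(3) in auto)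

lemma Ck_open_divide:
  fixes f g :: "'a::euclidean_space \<Rightarrow> real"
  assumes "open U" "Ck_open n U f" "Ck_open n U g" "\<And>x. x \<in> U \<Longrightarrow> g x \<noteq> 0"
  shows "Ck_open n U (\<lambda>x. f x / g x)"
  using Ck_open_mult[OF assms(1,2) Ck_open_inverse[OF assms(1,3,4)]] by (simp add: divide_inverse)

lemma Ck_open_sqrt: "Ck_open n {0<..} sqrt"
proof (induction n)
  case (Suc n)
  have "Ck_open n {0<..} (\<lambda>x. inverse (sqrt x) * (1/2))"
    using Suc by (intro Ck_open_mult Ck_open_inverse Ck_open_const) auto
  then show ?case
    by (intro Ck_open_real_SucI[where f' = "\<lambda>x. inverse (sqrt x) * (1/2)"])
      (auto intro!: derivative_eq_intros)
qed (auto intro!: continuous_intros)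

lemma Ck_open_arctan: "Ck_open n UNIV arctan"
proof (cases n)
  case (Suc m)
  have "1 + x * x \<noteq> 0" for x :: real
    using zero_le_square[of x] by linarith
  then have "Ck_open m UNIV (\<lambda>x::real. inverse (1 + x * x))"
    by (intro Ck_open_inverse Ck_open_add Ck_open_mult Ck_open_const Ck_open_ident) auto
  then show ?thesis unfolding Suc
    by (intro Ck_open_real_SucI[where f' = "\<lambda>x. inverse (1 + x * x)"])
      (auto intro!: derivative_eq_intros simp: power2_eq_square)
qed (auto intro!: continuous_intros)

text \<open>Truncated powers are the raw material for bumps of finite regularity: differentiation
  lowers the exponent by one. At the corner \<open>0\<close> the difference quotient is itself a
  truncated power and tends to 0.\<close>

lemma Ck_open_max_power: "Ck_open n UNIV (\<lambda>x::real. max 0 x ^ Suc n)"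
proof (induction n)
  case 0
  then show ?case by (auto intro!: continuous_intros)
next
  case (Suc n)
  have der: "((\<lambda>x::real. max 0 x ^ Suc (Suc n)) has_real_derivative of_nat (Suc (Suc n)) * max 0 x ^ Suc n) (at x)" for x
  proof (cases x "0::real" rule: linorder_cases)
    case less
    have "((\<lambda>x::real. 0) has_real_derivative of_nat (Suc (Suc n)) * max 0 x ^ Suc n) (at x)"
      using less by (auto intro!: derivative_eq_intros)
    then show ?thesis
      by (rule has_field_derivative_transform_within_open[where S = "{..<0}"]) (use less in auto)
  next
    case greater
    have "((\<lambda>x::real. x ^ Suc (Suc n)) has_real_derivative of_nat (Suc (Suc n)) * max 0 x ^ Suc n) (at x)"
      using greater DERIV_pow[of "Suc (Suc n)" x UNIV] by simp
    then show ?thesis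
      by (rule has_field_derivative_transform_within_open[where S = "{0<..}"]) (use greater in auto)
  next
    case equal
    have "((\<lambda>h::real. max 0 h ^ Suc n) \<longlongrightarrow> max 0 0 ^ Suc n) (at 0)"
      by (intro tendsto_intros)
    then have "((\<lambda>h::real. max 0 h ^ Suc n) \<longlongrightarrow> 0) (at 0)"
      by simp
    then have "((\<lambda>h::real. max 0 h ^ Suc (Suc n) / h) \<longlongrightarrow> 0) (at 0)"
      by (rule Lim_transform_eventually) (auto simp: eventually_at max_def intro!: exI[of _ 1])
    then show ?thesis using equal by (simp add: DERIV_def)
  qed
  show ?case
    using Suc by (intro Ck_open_real_SucI[OF _ der] Ck_open_mult Ck_open_const) auto
qed

section \<open>Jacobians and one-dimensional preparations\<close>

text \<open>Read off from the images of the two basis vectors; for linear \<open>L\<close> it is the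
  determinant.\<close>

definition jac :: "(plane \<Rightarrow> plane) \<Rightarrow> real" where
  "jac L = fst (L (1, 0)) * snd (L (0, 1)) - fst (L (0, 1)) * snd (L (1, 0))"

abbreviation jacobian :: "(plane \<Rightarrow> plane) \<Rightarrow> plane \<Rightarrow> real" where
  "jacobian \<phi> p \<equiv> jac (frechet_derivative \<phi> (at p))"

lemma linear_plane:
  fixes L :: "plane \<Rightarrow> 'a::real_vector"
  assumes "linear L"
  shows "L v = fst v *\<^sub>R L (1, 0) + snd v *\<^sub>R L (0, 1)"
proof -
  have "L v = L (fst v *\<^sub>R (1, 0) + snd v *\<^sub>R (0, 1))" by (cases v) simp
  then show ?thesis by (simp only: linear_add[OF assms] linear_scale[OF assms])
qed

text \<open>An alternating form on the plane is scaled by the determinant, and this form has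
  constant coefficients, so \<open>p\<close> and \<open>q\<close> may differ. It reduces
  preservation of the form to Jacobian 1.\<close>

lemma dx_wedge_dy_linear:
  assumes "linear L"
  shows "dx_wedge_dy q (L u) (L v) = jac L * dx_wedge_dy p u v"
  unfolding dx_wedge_dy_def jac_def linear_plane[OF assms, of u] linear_plane[OF assms, of v]
  by (simp add: algebra_simps)

lemma jac_compose:
  assumes "linear L"
  shows "jac (\<lambda>v. L (M v)) = jac L * jac M"
  using dx_wedge_dy_linear[OF assms, of 0 "M (1, 0)" "M (0, 1)" 0]
  by (simp add: dx_wedge_dy_def jac_def algebra_simps)

lemma jacobian_compose:
  assumes "\<psi> differentiable (at p)" "\<phi> differentiable (at (\<psi> p))"
  shows "jacobian (\<lambda>x. \<phi> (\<psi> x)) p = jacobian \<phi> (\<psi> p) * jacobian \<psi> p"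
proof -
  let ?D = "\<lambda>v. frechet_derivative \<phi> (at (\<psi> p)) (frechet_derivative \<psi> (at p) v)"
  have "((\<lambda>x. \<phi> (\<psi> x)) has_derivative ?D) (at p)"
    using has_derivative_compose[of \<psi> _ p UNIV \<phi>] assms frechet_derivative_works by blast
  then have "frechet_derivative (\<lambda>x. \<phi> (\<psi> x)) (at p) = ?D"
    by (rule frechet_derivative_at[symmetric])
  then show ?thesis
    using jac_compose[OF linear_frechet_derivative[OF assms(2)], of "frechet_derivative \<psi> (at p)"]
    by (simp only:)
qed

lemma frechet_derivative_cong:
  assumes "\<phi> differentiable (at p)" "open U" "p \<in> U" "\<And>x. x \<in> U \<Longrightarrow> \<phi> x = \<psi> x"
  shows "frechet_derivative \<psi> (at p) = frechet_derivative \<phi> (at p)"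
proof -
  have "(\<phi> has_derivative frechet_derivative \<phi> (at p)) (at p)"
    using assms(1) by (simp add: frechet_derivative_works)
  from has_derivative_transform_within_open[OF this assms(2-4)]
  show ?thesis by (rule frechet_derivative_at[symmetric])
qed

text \<open>With its companion below, this reads the columns of the Jacobian matrix off one-variable
  partial derivatives, once differentiability is known.\<close>

lemma frechet_derivative_fst_direction:
  fixes f :: "plane \<Rightarrow> 'a::real_normed_vector"
  assumes "f differentiable (at (a, b))" "((\<lambda>t. f (t, b)) has_vector_derivative d) (at a)"
  shows "frechet_derivative f (at (a, b)) (1, 0) = d"
proof -
  have "((\<lambda>t. (t, b)) has_derivative (\<lambda>t. (t, 0))) (at a)"
    by (auto intro!: derivative_eq_intros)
  from has_derivative_compose[OF this, of f] assms(1)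
  have "((\<lambda>t. f (t, b)) has_derivative (\<lambda>t. frechet_derivative f (at (a, b)) (t, 0))) (at a)"
    by (simp add: frechet_derivative_works)
  from fun_cong[OF has_derivative_unique[OF this assms(2)[unfolded has_vector_derivative_def]], of 1]
  show ?thesis by simp
qed

lemma frechet_derivative_snd_direction:
  fixes f :: "plane \<Rightarrow> 'a::real_normed_vector"
  assumes "f differentiable (at (a, b))" "((\<lambda>t. f (a, t)) has_vector_derivative d) (at b)"
  shows "frechet_derivative f (at (a, b)) (0, 1) = d"
proof -
  have "((\<lambda>t. (a, t)) has_derivative (\<lambda>t. (0, t))) (at b)"
    by (auto intro!: derivative_eq_intros)
  from has_derivative_compose[OF this, of f] assms(1)
  have "((\<lambda>t. f (a, t)) has_derivative (\<lambda>t. frechet_derivative f (at (a, b)) (0, t))) (at b)"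
    by (simp add: frechet_derivative_works)
  from fun_cong[OF has_derivative_unique[OF this assms(2)[unfolded has_vector_derivative_def]], of 1]
  show ?thesis by simp
qed

text \<open>A bootstrap: the derivative of the inverse is a rational expression in the derivatives
  of \<open>\<phi>\<close> evaluated at \<open>inv \<phi>\<close>, so C^n regularity of the inverse
  yields C^(n+1) as long as \<open>n < k\<close>.\<close>

lemma Ck_open_inv:
  fixes \<phi> :: "plane \<Rightarrow> plane"
  assumes "bij \<phi>" "Ck_open k UNIV \<phi>" "1 \<le> k" "\<And>p. jacobian \<phi> p \<noteq> 0"
  shows "Ck_open k UNIV (inv \<phi>)"
proof -
  obtain l where k: "k = Suc l" using assms(3) by (cases k) auto
  let ?\<psi> = "inv \<phi>"
  let ?D = "\<lambda>q. frechet_derivative \<phi> (at (?\<psi> q))"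
  \<comment> \<open>Cramer's rule for the inverse of the linear map \<open>?D q\<close>.\<close>
  define E where "E q v = (inverse (jac (?D q)) * (fst v * snd (?D q (0, 1)) - snd v * fst (?D q (0, 1))),
      inverse (jac (?D q)) * (snd v * fst (?D q (1, 0)) - fst v * snd (?D q (1, 0))))" for q and v :: plane
  have inv: "\<phi> (?\<psi> q) = q" for q using assms(1) by (simp add: bij_def surj_f_inv_f)
  \<comment> \<open>A continuous injection between spaces of equal dimension is open (invariance of
    domain), so the inverse is continuous.\<close>
  have cont: "continuous_on UNIV ?\<psi>"
    using continuous_on_inverse_open[of UNIV \<phi> ?\<psi>] assms(1,2)
    by (auto simp: bij_def Ck_open_imp_continuous_on)
  have der: "(?\<psi> has_derivative E q) (at q)" for q
  proof (rule has_derivative_inverse_basic[where f = \<phi> and T = UNIV])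
    show D: "(\<phi> has_derivative ?D q) (at (?\<psi> q))"
      using assms(2) unfolding k by (blast intro: Ck_open_has_derivative)
    show "bounded_linear (E q)"
      unfolding E_def
      by (intro bounded_linear_Pair bounded_linear_const_mult bounded_linear_sub
          bounded_linear_mult_const bounded_linear_fst bounded_linear_snd)
    have "E q (?D q v) = v" for v
      using assms(4)[of "?\<psi> q"] linear_plane[OF has_derivative_linear[OF D], of v]
      by (cases v) (simp add: E_def jac_def field_simps)
    then show "E q \<circ> ?D q = id" by auto
    show "continuous (at q) ?\<psi>" using cont by (cases q) (simp add: continuous_on_eq_continuous_at)
  qed (auto simp: inv)
  have "Ck_open n UNIV ?\<psi>" if "n \<le> k" for n
    using that
  proof (induction n)
    case 0
    show ?case using cont by simp
  next
    case (Suc n)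
    have D: "Ck_open n UNIV (\<lambda>q. ?D q v)" for v
      by (rule Ck_open_compose[where V = UNIV and f = ?\<psi>])
        (use Suc assms(2) k in \<open>auto intro: Ck_open_le Ck_open_frechet_derivative\<close>)
    have J: "Ck_open n UNIV (\<lambda>q. jac (?D q))"
      unfolding jac_def by (intro Ck_open_diff Ck_open_mult Ck_open_fst Ck_open_snd D open_UNIV)
    have "Ck_open n UNIV (\<lambda>q. E q v)" for v
      unfolding E_def
      by (intro Ck_open_Pair Ck_open_mult Ck_open_inverse J Ck_open_diff Ck_open_const Ck_open_fst
          Ck_open_snd D open_UNIV assms(4))
    then show ?case by (rule Ck_open_SucI[OF _ der, rotated]) simp
  qed
  then show ?thesis by simp
qed

section \<open>Real functions of one variable: bijections, antiderivatives, a cutoff profile, angle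
  functions\<close>

lemma bij_if_DERIV_pos:
  fixes f :: "real \<Rightarrow> real"
  assumes "\<And>x. (f has_real_derivative f' x) (at x)" "\<And>x. f' x > 0"
    and "\<And>y. \<exists>x. f x \<le> y" "\<And>y. \<exists>x. y \<le> f x"
  shows "bij f"
proof (rule bijI)
  have mono: "f x < f y" if "x < y" for x y
    using DERIV_pos_imp_increasing[OF that] assms(1,2) by blast
  then show "inj f" by (metis injI less_irrefl linorder_cases)
  have cont: "continuous_on UNIV f"
    using assms(1) by (meson DERIV_continuous continuous_at_imp_continuous_on)
  have "\<exists>x. f x = y" for y
  proof -
    obtain a b where ab: "f a \<le> y" "y \<le> f b" using assms(3,4) by blast
    then have "a \<le> b" using mono by (metis le_less_trans less_irrefl not_le order_less_le_trans)
    then show ?thesis using IVT'[of f a y b] ab cont continuous_on_subset by blast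
  qed
  then show "surj f" by (metis surj_def)
qed

lemma real_antiderivative:
  fixes f :: "real \<Rightarrow> real"
  assumes "continuous_on UNIV f"
  obtains F where "\<And>x. (F has_real_derivative f x) (at x)"
proof -
  have "\<exists>F. \<forall>x. -\<infinity> < ereal x \<longrightarrow> ereal x < \<infinity> \<longrightarrow> (F has_vector_derivative f x) (at x)"
    using assms by (intro einterval_antiderivative) (auto simp: continuous_on_eq_continuous_at)
  then show ?thesis using that by (auto simp: has_real_derivative_iff_has_vector_derivative)
qed

text \<open>Compact support forces the slope 1 at the origin to be compensated by negative slope.
  Spreading the descent over a wider interval than the ascent keeps it above \<open>- m\<close>; the
  support radius 1/4 stays fixed because only the ascent is narrowed.\<close>

lemma compact_support_profile:
  assumes "m > (0::real)"
  obtains w w' :: "real \<Rightarrow> real" where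
    "\<And>x. (w has_real_derivative w' x) (at x)" "Ck_open k UNIV w" "Ck_open k UNIV w'"
    "\<And>x. \<bar>x\<bar> \<ge> 1/4 \<Longrightarrow> w x = 0 \<and> w' x = 0" "w 0 = 0" "w' 0 = 1"
    "\<And>x. - m \<le> w' x" "\<And>x. w' x \<le> 1"
proof -
  \<comment> \<open>The factor 16 puts the support in \<open>\<bar>x\<bar> \<le> 1/4\<close>; the
    exponent \<open>Suc k\<close> gives class C^k.\<close>
  define B where "B x = max 0 (1 - 16 * x * x) ^ Suc k" for x :: real
  have CB: "Ck_open k UNIV B"
    unfolding B_def
    by (rule Ck_open_compose[OF _ _ _ Ck_open_max_power])
      (auto intro!: Ck_open_diff Ck_open_mult Ck_open_const Ck_open_ident)
  obtain P where P: "\<And>x. (P has_real_derivative B x) (at x)"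
    using real_antiderivative[OF Ck_open_imp_continuous_on[OF CB]] by blast
  \<comment> \<open>\<open>w'\<close> is a tall narrow bump minus a low wide bump of the same integral; \<open>s\<close> is the ratio of the
    widths.\<close>
  define s where "s = m / (1 + m)"
  have s: "0 < s" "s < 1" "m / s = 1 + m" using assms by (auto simp: s_def field_simps)
  \<comment> \<open>The factor \<open>m / s = 1 + m\<close> from the chain rule makes the formula
    for \<open>w'\<close> below the derivative of this \<open>w\<close>.\<close>
  define w where "w x = m * (P (x / s) - P x)" for x
  define w' where "w' x = (1 + m) * B (x / s) - m * B x" for x
  have B0: "0 \<le> B x" "B x \<le> 1" for x
    unfolding B_def by (auto intro!: power_le_one simp del: power_Suc)
  have big: "1/4 \<le> \<bar>x / s\<bar>" if "1/4 \<le> \<bar>x\<bar>" for x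
  proof -
    have "\<bar>x\<bar> * s \<le> \<bar>x\<bar>" using s by (intro mult_left_le) auto
    then have "\<bar>x\<bar> \<le> \<bar>x\<bar> / s" using s by (simp add: pos_le_divide_eq)
    then show ?thesis using that s by simp
  qed
  \<comment> \<open>\<open>B\<close> decreases in \<open>\<bar>x\<bar>\<close>, and division by
    \<open>s < 1\<close> enlarges \<open>\<bar>x\<bar>\<close>. Then
    \<open>(1 + m) * B (x / s) - m * B x\<close> is at most \<open>B (x / s)\<close>, which yields
    the upper bound 1.\<close>
  have Bmono: "B (x / s) \<le> B x" for x
  proof -
    have "s * s \<le> 1" using s by (simp add: mult_le_one)
    then have "x * x * (s * s) \<le> x * x" by (intro mult_left_le) auto
    then have "x * x \<le> (x / s) * (x / s)" using s by (simp add: pos_le_divide_eq)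
    then show ?thesis unfolding B_def by (intro power_mono) auto
  qed
  have Bout: "B x = 0" if "1/4 \<le> \<bar>x\<bar>" for x
  proof -
    have "(1/4) * (1/4) \<le> \<bar>x\<bar> * \<bar>x\<bar>" using that by (intro mult_mono) auto
    then show ?thesis by (simp add: B_def max_def)
  qed
  \<comment> \<open>\<open>P\<close> is constant on each half-line outside the support of
    \<open>B\<close>. There \<open>x\<close> and \<open>x / s\<close> lie on the same half-line, so
    their values cancel in \<open>w\<close>.\<close>
  have const: "P x = P y" if xy: "x \<in> S" "y \<in> S" and S: "convex S" "\<And>z. z \<in> S \<Longrightarrow> 1/4 \<le> \<bar>z\<bar>" for x y S
  proof -
    have "(P has_real_derivative 0) (at z within S)" if "z \<in> S" for z
      using P[of z] Bout[OF S(2)[OF that]] by (auto intro: DERIV_subset)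
    then obtain c where "\<And>z. z \<in> S \<Longrightarrow> P z = c"
      using has_field_derivative_zero_constant[OF S(1)] by blast
    then show ?thesis using xy by simp
  qed
  have wout: "w x = 0" if "1/4 \<le> \<bar>x\<bar>" for x
  proof -
    have "P (x / s) = P x"
    proof (cases "x > 0")
      case True
      then show ?thesis using that big[OF that] s by (intro const[of _ "{1/4..}"]) auto
    next
      case False
      have "x / s \<le> 0" using False s by (simp add: divide_le_0_iff)
      then have "x / s \<le> - 1/4" "x \<le> - 1/4" using that big[OF that] False by linarith+
      then show ?thesis by (intro const[of _ "{..-1/4}"]) auto
    qed
    then show ?thesis by (simp add: w_def)
  qed
  have "((\<lambda>x. P (x / s)) has_real_derivative B (x / s) * (1 / s)) (at x)" for x
    using s by (intro DERIV_chain2[OF P]) (auto intro!: derivative_eq_intros)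
  then have dw: "(w has_real_derivative w' x) (at x)" for x
    unfolding w_def w'_def
    by (auto intro!: derivative_eq_intros P simp: s(3)[symmetric] field_simps)
  have Cw': "Ck_open k UNIV w'"
    unfolding w'_def divide_inverse
    by (intro Ck_open_diff Ck_open_mult Ck_open_const CB Ck_open_compose[OF _ _ _ CB] Ck_open_ident) auto
  have Cw: "Ck_open k UNIV w"
    using Ck_open_real_SucI[OF _ dw Cw'] by (simp add: Ck_open_Suc_imp)
  have lower: "- m \<le> w' x" for x
    using mult_left_mono[OF B0(2)[of x], of m] mult_nonneg_nonneg[OF _ B0(1)[of "x / s"], of "1 + m"] assms
    unfolding w'_def by linarith
  have upper: "w' x \<le> 1" for x
    using mult_left_mono[OF Bmono[of x], of m] B0(2)[of "x / s"] assms
    unfolding w'_def distrib_right by linarith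
  have "w x = 0 \<and> w' x = 0" if "1/4 \<le> \<bar>x\<bar>" for x
    using wout[OF that] Bout[OF that] Bout[OF big[OF that]] by (simp add: w'_def)
  then show ?thesis
    by (rule that[OF dw Cw Cw' _ _ _ lower upper]) (auto simp: w'_def w_def B_def)
qed

text \<open>\<open>F\<close> integrates the angular speed from an initial angle. The curve and
  \<open>(cos F, sin F)\<close> then solve the same linear differential equation with the same
  initial value.\<close>

lemma circle_curve_angle:
  fixes x y x' y' :: "real \<Rightarrow> real"
  assumes x: "\<And>t. (x has_real_derivative x' t) (at t)" and y: "\<And>t. (y has_real_derivative y' t) (at t)"
    and cont: "continuous_on UNIV x'" "continuous_on UNIV y'"
    and circle: "\<And>t. (x t)\<^sup>2 + (y t)\<^sup>2 = 1"
  obtains F where "\<And>t. (F has_real_derivative x t * y' t - y t * x' t) (at t)"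
    "\<And>t. x t = cos (F t)" "\<And>t. y t = sin (F t)"
proof -
  define \<omega> where "\<omega> t = x t * y' t - y t * x' t" for t
  have "continuous_on UNIV x" "continuous_on UNIV y"
    using x y by (meson DERIV_continuous continuous_at_imp_continuous_on)+
  then have "continuous_on UNIV \<omega>"
    unfolding \<omega>_def by (intro continuous_intros cont)
  then obtain H where H: "\<And>t. (H has_real_derivative \<omega> t) (at t)"
    using real_antiderivative by blast
  obtain a where a: "x 0 = cos a" "y 0 = sin a"
    using sincos_total_2pi[OF circle[of 0]] by metis
  define F where "F t = H t - H 0 + a" for t
  have F: "(F has_real_derivative \<omega> t) (at t)" for t
    unfolding F_def by (auto intro!: derivative_eq_intros H)
  \<comment> \<open>Differentiating the circle equation shows that the velocity is tangent, hence
    equal to \<open>\<omega> t\<close> times the rotated position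
    \<open>(- y t, x t)\<close>.\<close>
  have orth: "x t * x' t + y t * y' t = 0" for t
  proof -
    have "((\<lambda>t. (x t)\<^sup>2 + (y t)\<^sup>2) has_real_derivative 2 * (x t * x' t + y t * y' t)) (at t)"
      by (auto intro!: derivative_eq_intros x y)
    moreover have "((\<lambda>t. (x t)\<^sup>2 + (y t)\<^sup>2) has_real_derivative 0) (at t)"
      by (simp add: circle)
    ultimately show ?thesis using DERIV_unique by fastforce
  qed
  have x': "x' t = - y t * \<omega> t" for t
  proof -
    have "- y t * \<omega> t = x' t * ((x t)\<^sup>2 + (y t)\<^sup>2) - x t * (x t * x' t + y t * y' t)"
      unfolding \<omega>_def by (simp add: algebra_simps power2_eq_square)
    then show ?thesis by (simp add: circle orth)
  qed
  have y': "y' t = x t * \<omega> t" for t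
  proof -
    have "x t * \<omega> t = y' t * ((x t)\<^sup>2 + (y t)\<^sup>2) - y t * (x t * x' t + y t * y' t)"
      unfolding \<omega>_def by (simp add: algebra_simps power2_eq_square)
    then show ?thesis by (simp add: circle orth)
  qed
  \<comment> \<open>The inner product with \<open>(cos (F t), sin (F t))\<close>, and below it the
    cross product, are constant. Their initial values 1 and 0 force the two unit vectors to
    coincide.\<close>
  have "((\<lambda>t. x t * cos (F t) + y t * sin (F t)) has_real_derivative 0) (at t)" for t
    by (auto intro!: derivative_eq_intros x y F simp: x' y' algebra_simps)
  then have c: "x t * cos (F t) + y t * sin (F t) = x 0 * cos (F 0) + y 0 * sin (F 0)" for t
    using DERIV_isconst_all by blast
  have "((\<lambda>t. y t * cos (F t) - x t * sin (F t)) has_real_derivative 0) (at t)" for t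
    by (auto intro!: derivative_eq_intros x y F simp: x' y' algebra_simps)
  then have d: "y t * cos (F t) - x t * sin (F t) = y 0 * cos (F 0) - x 0 * sin (F 0)" for t
    using DERIV_isconst_all by blast
  have c1: "x t * cos (F t) + y t * sin (F t) = 1" for t
    by (subst c) (simp add: F_def a flip: power2_eq_square)
  have d0: "y t * cos (F t) - x t * sin (F t) = 0" for t
    by (subst d) (simp add: F_def a)
  have "x t = cos (F t)" for t
  proof -
    have "x t * ((sin (F t))\<^sup>2 + (cos (F t))\<^sup>2) = cos (F t) * (x t * cos (F t) + y t * sin (F t))
        - sin (F t) * (y t * cos (F t) - x t * sin (F t))"
      by algebra
    then show ?thesis
      by (simp only: c1 d0 sin_cos_squared_add mult_1_right mult_zero_right diff_zero add_0_right)
  qed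
  moreover have "y t = sin (F t)" for t
  proof -
    have "y t * ((sin (F t))\<^sup>2 + (cos (F t))\<^sup>2) = sin (F t) * (x t * cos (F t) + y t * sin (F t))
        + cos (F t) * (y t * cos (F t) - x t * sin (F t))"
      by algebra
    then show ?thesis
      by (simp only: c1 d0 sin_cos_squared_add mult_1_right mult_zero_right diff_zero add_0_right)
  qed
  ultimately show ?thesis using that F unfolding \<omega>_def by blast
qed

section \<open>The symplectic map of the cylinder\<close>

text \<open>\<open>F\<close> is the angle function of \<open>f\<close> along the standard
  parametrization. Orientation gives \<open>F' > 0\<close>, injectivity gives degree 1, and
  \<open>F\<close> is C^k because its derivative, the angular speed, is of class one lower.\<close>

lemma circle_diffeo_lift:
  fixes f :: "plane \<Rightarrow> plane"
  assumes k: "k \<ge> 1" and diffeo: "Ck_diffeo k unit_circle unit_circle f"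
    and orient: "circle_orientation_preserving f"
  obtains F F' :: "real \<Rightarrow> real" where
    "\<And>t. (F has_real_derivative F' t) (at t)" "\<And>t. F' t > 0"
    "continuous_on UNIV F'" "Ck_open k UNIV F"
    "\<And>t. f (cos t, sin t) = (cos (F t), sin (F t))"
    "\<And>t (n::int). F (t + 2 * pi * n) = F t + 2 * pi * n"
proof -
  obtain l where l: "k = Suc l" using k by (cases k) auto
  define c where "c t = (cos t, sin t)" for t :: real
  define h where "h t = f (c t)" for t
  have c_circle: "c t \<in> unit_circle" for t by (simp add: c_def norm_Pair)
  have h_circle: "h t \<in> unit_circle" for t
    using diffeo c_circle unfolding Ck_diffeo_def bij_betw_def h_def by blast
  have Cc: "Ck_open n UNIV c" for n
    unfolding c_def by (intro Ck_open_Pair Ck_open_sin_cos open_UNIV)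
  have Ch: "Ck_open k UNIV h"
  proof (rule Ck_open_locally)
    fix t
    obtain U g where U: "open U" "c t \<in> U" "Ck_open k U g" "\<And>y. y \<in> unit_circle \<inter> U \<Longrightarrow> g y = f y"
      using diffeo c_circle[of t] unfolding Ck_diffeo_def Ck_on_def by blast
    have V: "open (c -` U)"
      using U(1) Ck_open_imp_continuous_on[OF Cc] by (simp add: continuous_on_open_vimage)
    have "Ck_open k (c -` U) (\<lambda>t. g (c t))"
      using Cc by (intro Ck_open_compose[OF V U(1) _ U(3)]) (auto intro: Ck_open_subset)
    then have "Ck_open k (c -` U) h"
      by (rule Ck_open_cong[OF V, rotated]) (use U(4) c_circle in \<open>auto simp: h_def\<close>)
    then show "\<exists>V. open V \<and> t \<in> V \<and> Ck_open k V h" using V U(2) by blast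
  qed
  define h' where "h' t = frechet_derivative h (at t) 1" for t
  have dh: "(h has_vector_derivative h' t) (at t)" for t
  proof -
    have D: "(h has_derivative frechet_derivative h (at t)) (at t)"
      using Ch unfolding l by (intro Ck_open_has_derivative) auto
    have "frechet_derivative h (at t) v = v *\<^sub>R h' t" for v
      using linear_scale[OF has_derivative_linear[OF D], of v 1] by (simp add: h'_def)
    then have "frechet_derivative h (at t) = (\<lambda>v. v *\<^sub>R h' t)" by blast
    then show ?thesis using D by (simp add: has_vector_derivative_def)
  qed
  have Ch': "Ck_open l UNIV h'"
    unfolding h'_def using Ch l by (auto intro: Ck_open_frechet_derivative)
  have dx: "((\<lambda>t. fst (h t)) has_real_derivative fst (h' t)) (at t)" for t
    using bounded_linear.has_vector_derivative[OF bounded_linear_fst dh]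
    by (simp add: has_real_derivative_iff_has_vector_derivative)
  have dy: "((\<lambda>t. snd (h t)) has_real_derivative snd (h' t)) (at t)" for t
    using bounded_linear.has_vector_derivative[OF bounded_linear_snd dh]
    by (simp add: has_real_derivative_iff_has_vector_derivative)
  define \<omega> where "\<omega> t = fst (h t) * snd (h' t) - snd (h t) * fst (h' t)" for t
  have C\<omega>: "Ck_open l UNIV \<omega>"
    unfolding \<omega>_def using Ch Ch' l
    by (intro Ck_open_diff Ck_open_mult Ck_open_fst Ck_open_snd) (auto intro: Ck_open_Suc_imp)
  have circle: "(fst (h t))\<^sup>2 + (snd (h t))\<^sup>2 = 1" for t
    using h_circle[of t] by (simp add: norm_prod_def)
  obtain F where F: "\<And>t. (F has_real_derivative \<omega> t) (at t)"
    "\<And>t. fst (h t) = cos (F t)" "\<And>t. snd (h t) = sin (F t)"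
    using circle_curve_angle[OF dx dy _ _ circle] Ck_open_imp_continuous_on[OF Ch']
      continuous_on_fst continuous_on_snd unfolding \<omega>_def by metis
  \<comment> \<open>The inner product in the orientation hypothesis is exactly the angular speed
    \<open>\<omega> t\<close>.\<close>
  have pos: "\<omega> t > 0" for t
  proof -
    have "vector_derivative (\<lambda>s. f (cos s, sin s)) (at t) = h' t"
      using dh[of t] unfolding h_def c_def by (rule vector_derivative_at)
    then show ?thesis
      using orient[unfolded circle_orientation_preserving_def Let_def, rule_format, of t]
      by (simp add: \<omega>_def h_def c_def inner_prod_def algebra_simps)
  qed
  have hF: "h t = (cos (F t), sin (F t))" for t
    using F(2,3)[of t] by (simp add: prod_eq_iff)
  have mono: "F s < F t" if "s < t" for s t
    using DERIV_pos_imp_increasing[OF that] F(1) pos by blast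
  have contF: "continuous_on S F" for S
    using F(1) by (meson DERIV_continuous continuous_at_imp_continuous_on)
  \<comment> \<open>Injectivity of \<open>f\<close> forces the winding number \<open>n\<close> below to be 1.\<close>
  have inj: "\<exists>n::int. s = t + 2 * pi * n" if "h s = h t" for s t
  proof -
    have "c s = c t"
      using that diffeo c_circle unfolding Ck_diffeo_def bij_betw_def h_def inj_on_def by blast
    then show ?thesis using sin_cos_eq_iff[of s t] by (simp add: c_def)
  qed
  have per1: "F (t + 2 * pi) = F t + 2 * pi" for t
  proof -
    have "h (t + 2 * pi) = h t" by (simp add: h_def c_def)
    then obtain n :: int where n: "F (t + 2 * pi) = F t + 2 * pi * n"
      using sin_cos_eq_iff[of "F (t + 2 * pi)" "F t"] by (auto simp: hF)
    have "0 < 2 * pi * n" using mono[of t "t + 2 * pi"] n by simp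
    then have "0 < n" by (simp add: zero_less_mult_iff)
    moreover have "n < 2"
    proof (rule ccontr)
      assume "\<not> n < 2"
      then have "2 * pi * 2 \<le> 2 * pi * n" by (intro mult_left_mono) auto
      then have "F t + 2 * pi < F (t + 2 * pi)" using n by (simp add: algebra_simps)
      \<comment> \<open>If \<open>f\<close> wound around more than once, \<open>F\<close> would gain
        \<open>2 * pi\<close> strictly before the period ends, and \<open>h\<close> would repeat a
        value there.\<close>
      then obtain s where s: "t \<le> s" "s \<le> t + 2 * pi" "F s = F t + 2 * pi"
        using IVT'[of F t "F t + 2 * pi" "t + 2 * pi"] contF by auto
      with \<open>F t + 2 * pi < F (t + 2 * pi)\<close> have strict: "t < s" "s < t + 2 * pi"
        by (auto simp: order_less_le)
      obtain m :: int where m: "s = t + 2 * pi * m"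
        using inj[of s t] s(3) by (auto simp: hF)
      then have "0 < 2 * pi * m" "2 * pi * m < 2 * pi * 1" using strict by auto
      then have "0 < real_of_int m" "real_of_int m < 1"
        by (simp_all only: zero_less_mult_iff mult_less_cancel_left_pos[of "2 * pi"]) auto
      then have "0 < m" "m < 1" by simp_all
      then show False by linarith
    qed
    ultimately have "n = 1" by linarith
    then show ?thesis using n by simp
  qed
  have per: "F (t + 2 * pi * n) = F t + 2 * pi * n" for t and n :: int
  proof (induction n rule: int_induct[where k = 0])
    case (step1 i)
    then show ?case using per1[of "t + 2 * pi * i"] by (simp add: algebra_simps)
  next
    case (step2 i)
    then show ?case using per1[of "t + 2 * pi * (i - 1)"] by (simp add: algebra_simps)
  qed simp
  have "Ck_open k UNIV F"
    unfolding l by (rule Ck_open_real_SucI[OF open_UNIV F(1) C\<omega>])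
  then show ?thesis
    using that[OF F(1) pos Ck_open_imp_continuous_on[OF C\<omega>] _ _ per] hF
    by (simp add: h_def c_def)
qed

text \<open>\<open>F'\<close> inherits the period \<open>2 * pi\<close>, so a bound on the compact
  interval \<open>{0..2 * pi}\<close> is global. This bound determines how steeply the profile
  \<open>w\<close> may descend.\<close>

lemma periodic_derivative_bounded:
  fixes F F' :: "real \<Rightarrow> real"
  assumes F: "\<And>t. (F has_real_derivative F' t) (at t)" and cont: "continuous_on UNIV F'"
    and per: "\<And>t (n::int). F (t + 2 * pi * n) = F t + 2 * pi * n"
  obtains M where "M > 0" "\<And>t. F' t \<le> M"
proof -
  have shift: "F' (t + 2 * pi * n) = F' t" for t and n :: int
  proof -
    have "((\<lambda>t. F (t + 2 * pi * n)) has_real_derivative F' (t + 2 * pi * n)) (at t)"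
      using F[of "t + 2 * pi * n"] by (simp only: DERIV_shift)
    moreover have "((\<lambda>t. F t + 2 * pi * n) has_real_derivative F' t) (at t)"
      by (auto intro!: derivative_eq_intros F)
    ultimately show ?thesis unfolding per by (rule DERIV_unique)
  qed
  have "compact (F' ` {0..2 * pi})"
    using cont by (intro compact_continuous_image) (auto intro: continuous_on_subset)
  then obtain M where M: "M > 0" "\<And>t. t \<in> {0..2 * pi} \<Longrightarrow> \<bar>F' t\<bar> \<le> M"
    using bounded_pos[of "F' ` {0..2 * pi}"] by (auto dest!: compact_imp_bounded)
  have "F' t \<le> M" for t
  proof -
    define n where "n = - \<lfloor>t / (2 * pi)\<rfloor>"
    have "t / (2 * pi) + n \<in> {0..1}" unfolding n_def by (simp; linarith)
    then have "2 * pi * (t / (2 * pi) + n) \<in> {0..2 * pi}" by (auto intro!: mult_left_le)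
    then have "t + 2 * pi * n \<in> {0..2 * pi}" by (simp add: algebra_simps)
    then show ?thesis using M(2)[of "t + 2 * pi * n"] shift[of t n] by simp
  qed
  then show ?thesis using that M(1) by blast
qed

section \<open>The area-preserving map defined by the generating function\<close>

lemma bij_fibrewise_snd:
  assumes "\<And>x. bij (g x)"
  shows "bij (\<lambda>p. (fst p, g (fst p) (snd p)))"
proof (rule bijI)
  show "inj (\<lambda>p. (fst p, g (fst p) (snd p)))"
    using assms by (auto simp: inj_def bij_def prod_eq_iff)
  have "\<exists>p. q = (fst p, g (fst p) (snd p))" for q
  proof -
    obtain z where "snd q = g (fst q) z" using bij_is_surj[OF assms] by (auto simp: surj_def)
    then show ?thesis by (intro exI[of _ "(fst q, z)"]) (simp add: prod_eq_iff)
  qed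
  then show "surj (\<lambda>p. (fst p, g (fst p) (snd p)))" by (simp add: surj_def)
qed

lemma bij_fibrewise_fst:
  assumes "\<And>y. bij (g y)"
  shows "bij (\<lambda>p. (g (snd p) (fst p), snd p))"
proof -
  have "bij (prod.swap \<circ> (\<lambda>p. (fst p, g (fst p) (snd p))) \<circ> prod.swap)"
    by (intro bij_comp bij_fibrewise_snd assms bij_swap)
  then show ?thesis by (simp add: comp_def)
qed

text \<open>The coordinate changes \<open>A\<close> and \<open>B\<close> are built from
  \<open>F\<close>, \<open>w\<close> and \<open>w'\<close> but not from \<open>F'\<close>, hence are
  C^k. Monotonicity on fibres makes them bijective, and \<open>\<Phi>\<close> is \<open>B\<close>
  after the inverse of \<open>A\<close>.\<close>

lemma cylinder_map_exists:
  fixes F F' :: "real \<Rightarrow> real"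
  assumes k: "k \<ge> 1"
    and F: "\<And>t. (F has_real_derivative F' t) (at t)" and pos: "\<And>t. F' t > 0"
    and cont: "continuous_on UNIV F'" and CF: "Ck_open k UNIV F"
    and per: "\<And>t (n::int). F (t + 2 * pi * n) = F t + 2 * pi * n"
  obtains \<Phi> :: "plane \<Rightarrow> plane" where
    "bij \<Phi>" "Ck_open k UNIV \<Phi>" "Ck_open k UNIV (inv \<Phi>)" "\<And>p. jacobian \<Phi> p = 1"
    "\<And>p (n::int). \<Phi> (p + (2 * pi * n, 0)) = \<Phi> p + (2 * pi * n, 0)"
    "\<And>p. \<bar>snd p\<bar> \<ge> 1/4 \<Longrightarrow> \<Phi> p = p" "\<And>t. \<Phi> (t, 0) = (F t, 0)"
proof -
  obtain M where M: "M > 0" "\<And>t. F' t \<le> M"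
    using periodic_derivative_bounded[OF F cont per] by blast
  obtain w w' where w: "\<And>x. (w has_real_derivative w' x) (at x)"
    and Cw: "Ck_open k UNIV w" "Ck_open k UNIV w'"
    and w_out: "\<And>x. \<bar>x\<bar> \<ge> 1/4 \<Longrightarrow> w x = 0 \<and> w' x = 0"
    and w0: "w 0 = 0" "w' 0 = 1" and w_bounds: "\<And>x. - inverse M \<le> w' x" "\<And>x. w' x \<le> 1"
    using compact_support_profile[of "inverse M" k] M(1) by (metis positive_imp_inverse_positive)
  \<comment> \<open>\<open>\<alpha> = \<partial>\<^sub>t S\<close>, \<open>\<beta> = \<partial>\<^sub>J S\<close>, and \<open>D\<close> is the mixed second derivative of \<open>S\<close>, which is the
    Jacobian of both \<open>A\<close> and \<open>B\<close>; hence \<open>B \<circ> A\<^sup>-\<^sup>1\<close> preserves area.\<close>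
  define \<alpha> where "\<alpha> t J = J - w J + (F (t + w J) - F (t - w J)) / 2" for t J
  define \<beta> where "\<beta> J t = t * (1 - w' J) + w' J * ((F (t + w J) + F (t - w J)) / 2)" for t J
  define D where "D t J = 1 - w' J + w' J * ((F' (t + w J) + F' (t - w J)) / 2)" for t J
  define A where "A p = (fst p, \<alpha> (fst p) (snd p))" for p :: plane
  define B where "B p = (\<beta> (snd p) (fst p), snd p)" for p :: plane
  \<comment> \<open>With \<open>a\<close> the mean of two values of \<open>F'\<close>,
    \<open>D\<close> is \<open>1 - w' J + w' J * a\<close>. For positive \<open>w' J\<close> the
    bound \<open>w' J \<le> 1\<close> suffices; for negative \<open>w' J\<close> the lower bound
    gives \<open>1 + w' J * a \<ge> 0\<close>, and \<open>- w' J\<close> is strictly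
    positive.\<close>
  have D_pos: "D t J > 0" for t J
  proof -
    define a where "a = (F' (t + w J) + F' (t - w J)) / 2"
    have a: "0 < a" "a \<le> M"
      using pos[of "t + w J"] pos[of "t - w J"] M(2)[of "t + w J"] M(2)[of "t - w J"]
      by (simp_all add: a_def)
    show ?thesis
    proof (cases "w' J > 0")
      case True
      then have "w' J * a > 0" using a by simp
      then show ?thesis using w_bounds(2)[of J] by (simp add: D_def flip: a_def)
    next
      case False
      have "- w' J * a \<le> - w' J * M" using False a by (intro mult_left_mono) auto
      moreover have "- w' J * M \<le> inverse M * M"
        using w_bounds(1)[of J] M(1) by (intro mult_right_mono) auto
      moreover have "inverse M * M = 1" using M(1) by simp
      ultimately have "0 \<le> 1 + w' J * a" by simp
      then show ?thesis
      proof (cases "w' J = 0")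
        case False
        then show ?thesis using \<open>\<not> w' J > 0\<close> \<open>0 \<le> 1 + w' J * a\<close> by (simp add: D_def flip: a_def)
      qed (simp add: D_def)
    qed
  qed
  have d\<alpha>: "((\<lambda>J. \<alpha> t J) has_real_derivative D t J) (at J)" for t J
    unfolding \<alpha>_def D_def
    by (auto intro!: derivative_eq_intros DERIV_chain2[OF F] w simp: field_simps)
  have d\<beta>: "((\<lambda>t. \<beta> J t) has_real_derivative D t J) (at t)" for t J
    unfolding \<beta>_def D_def
    by (auto intro!: derivative_eq_intros DERIV_chain2[OF F] simp: field_simps)
  have \<alpha>_out: "\<alpha> t J = J" if "\<bar>J\<bar> \<ge> 1/4" for t J
    using w_out[OF that] by (simp add: \<alpha>_def)
  have \<beta>_out: "\<beta> J t = t" if "\<bar>J\<bar> \<ge> 1/4" for t J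
    using w_out[OF that] by (simp add: \<beta>_def)
  have per': "F (t + 2 * pi * n + s) = F (t + s) + 2 * pi * n"
    "F (t + 2 * pi * n - s) = F (t - s) + 2 * pi * n" for t s and n :: int
    using per[of "t + s" n] per[of "t - s" n] by (simp_all add: algebra_simps)
  have \<alpha>_per: "\<alpha> (t + 2 * pi * n) J = \<alpha> t J" for t J and n :: int
    unfolding \<alpha>_def per' by simp
  \<comment> \<open>The weights \<open>1 - w' J\<close> and \<open>w' J\<close> add up to 1, so the
    translation passes through unchanged.\<close>
  have \<beta>_per: "\<beta> J (t + 2 * pi * n) = \<beta> J t + 2 * pi * n" for t J and n :: int
    unfolding \<beta>_def per' by (simp add: field_simps)
  have bijA: "bij A"
    unfolding A_def
  proof (intro bij_fibrewise_snd bij_if_DERIV_pos[OF d\<alpha> D_pos])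
    fix t y
    show "\<exists>J. \<alpha> t J \<le> y" by (rule exI[of _ "min y (- 1/4)"]) (simp add: \<alpha>_out)
    show "\<exists>J. y \<le> \<alpha> t J" by (rule exI[of _ "max y (1/4)"]) (simp add: \<alpha>_out)
  qed
  have bijB: "bij B"
    unfolding B_def
  proof (intro bij_fibrewise_fst bij_if_DERIV_pos[OF d\<beta> D_pos])
    fix J y
    \<comment> \<open>\<open>r\<close> counts the periods from \<open>\<beta> J 0\<close> to
      \<open>y\<close>; rounding it down and up gives arguments with values below and above
      \<open>y\<close>.\<close>
    define r where "r = (y - \<beta> J 0) / (2 * pi)"
    have r: "\<beta> J 0 + 2 * pi * r = y" by (simp add: r_def)
    have "\<beta> J (0 + 2 * pi * \<lfloor>r\<rfloor>) \<le> \<beta> J 0 + 2 * pi * r"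
      unfolding \<beta>_per by simp
    then show "\<exists>t. \<beta> J t \<le> y" unfolding r by blast
    have "\<beta> J 0 + 2 * pi * r \<le> \<beta> J (0 + 2 * pi * \<lceil>r\<rceil>)"
      unfolding \<beta>_per by simp
    then show "\<exists>t. y \<le> \<beta> J t" unfolding r by blast
  qed
  note Ck_intros = Ck_open_Pair Ck_open_add Ck_open_diff Ck_open_mult Ck_open_const Ck_open_fst Ck_open_snd
    Ck_open_ident Ck_open_compose[OF open_UNIV open_UNIV subset_UNIV CF]
    Ck_open_compose[OF open_UNIV open_UNIV subset_UNIV Cw(1)]
    Ck_open_compose[OF open_UNIV open_UNIV subset_UNIV Cw(2)] open_UNIV
  have CA: "Ck_open k UNIV A"
    unfolding A_def \<alpha>_def divide_inverse by (intro Ck_intros)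
  have CB: "Ck_open k UNIV B"
    unfolding B_def \<beta>_def divide_inverse by (intro Ck_intros)
  have difA: "A differentiable (at p)" and difB: "B differentiable (at p)" for p
    using Ck_open_differentiable[OF _ k] CA CB by blast+
  have jacA: "jacobian A (t, J) = D t J" for t J
  proof -
    have "((\<lambda>t. \<alpha> t J) has_real_derivative (F' (t + w J) - F' (t - w J)) / 2) (at t)"
      unfolding \<alpha>_def by (auto intro!: derivative_eq_intros DERIV_chain2[OF F])
    then have "((\<lambda>t. A (t, J)) has_vector_derivative (1, (F' (t + w J) - F' (t - w J)) / 2)) (at t)"
      unfolding A_def fst_conv snd_conv
      by (intro has_vector_derivative_Pair has_vector_derivative_id)
        (simp add: has_real_derivative_iff_has_vector_derivative)
    moreover have "((\<lambda>J. A (t, J)) has_vector_derivative (0, D t J)) (at J)"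
      unfolding A_def fst_conv snd_conv using d\<alpha>
      by (intro has_vector_derivative_Pair has_vector_derivative_const)
        (simp add: has_real_derivative_iff_has_vector_derivative)
    ultimately show ?thesis
      by (simp add: jac_def frechet_derivative_fst_direction[OF difA]
          frechet_derivative_snd_direction[OF difA])
  qed
  have jacB: "jacobian B (t, J) = D t J" for t J
  proof -
    have "((\<lambda>t. B (t, J)) has_vector_derivative (D t J, 0)) (at t)"
      unfolding B_def fst_conv snd_conv using d\<beta>
      by (intro has_vector_derivative_Pair has_vector_derivative_const)
        (simp add: has_real_derivative_iff_has_vector_derivative)
    then have "frechet_derivative B (at (t, J)) (1, 0) = (D t J, 0)"
      by (rule frechet_derivative_fst_direction[OF difB])
    \<comment> \<open>The matrix of \<open>B\<close> is upper triangular, so the derivative of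
      \<open>\<beta>\<close> with respect to \<open>J\<close> does not enter the
      determinant.\<close>
    moreover have "snd (frechet_derivative B (at (t, J)) (0, 1)) = 1"
    proof -
      have "((\<lambda>p. snd (B p)) has_derivative (\<lambda>v. snd (frechet_derivative B (at (t, J)) v))) (at (t, J))"
        using difB[of "(t, J)"] by (intro has_derivative_snd) (simp add: frechet_derivative_works)
      moreover have "((\<lambda>p. snd (B p)) has_derivative snd) (at (t, J))"
        unfolding B_def snd_conv by (auto intro!: derivative_eq_intros)
      ultimately show ?thesis
        by (metis has_derivative_unique snd_conv)
    qed
    ultimately show ?thesis by (simp add: jac_def)
  qed
  have CinvA: "Ck_open k UNIV (inv A)" and CinvB: "Ck_open k UNIV (inv B)"
    using Ck_open_inv[OF bijA CA k] Ck_open_inv[OF bijB CB k] D_pos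
    by (metis jacA jacB less_irrefl surj_pair)+
  have invA: "inv A (A p) = p" "A (inv A p) = p" and invB: "inv B (B p) = p" "B (inv B p) = p" for p
    using bijA bijB by (auto simp: bij_def surj_f_inv_f)
  define \<Phi> where "\<Phi> p = B (inv A p)" for p
  have \<Phi>A: "\<Phi> (A p) = B p" for p by (simp add: \<Phi>_def invA)
  have C\<Phi>: "Ck_open k UNIV \<Phi>"
    unfolding \<Phi>_def by (intro Ck_open_compose[OF _ _ _ CB] CinvA) auto
  have bij\<Phi>: "bij \<Phi>" and inv\<Phi>: "inv \<Phi> = (\<lambda>p. A (inv B p))"
  proof -
    have "\<Phi> \<circ> (\<lambda>p. A (inv B p)) = id" "(\<lambda>p. A (inv B p)) \<circ> \<Phi> = id"
      by (auto simp: \<Phi>_def invA invB)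
    then show "bij \<Phi>" "inv \<Phi> = (\<lambda>p. A (inv B p))"
      by (auto intro: o_bij inv_unique_comp)
  qed
  have "jacobian \<Phi> p = 1" for p
  proof -
    obtain t J where p: "p = A (t, J)" using invA(2)[of p] by (metis surj_pair)
    \<comment> \<open>The chain rule applied to \<open>\<Phi> (A p) = B p\<close>; both
      \<open>A\<close> and \<open>B\<close> have Jacobian \<open>D\<close>.\<close>
    have "jacobian \<Phi> p * D t J = D t J"
      using jacobian_compose[OF difA[of "(t, J)"], of \<Phi>] Ck_open_differentiable[OF C\<Phi> k]
      by (simp add: \<Phi>A jacA jacB p)
    then show ?thesis using D_pos[of t J] by simp
  qed
  moreover have "\<Phi> (p + (2 * pi * n, 0)) = \<Phi> p + (2 * pi * n, 0)" for p and n :: int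
  proof -
    obtain q where p: "p = A q" using invA(2)[of p] by metis
    have "A (q + (2 * pi * n, 0)) = A q + (2 * pi * n, 0)"
      by (cases q) (simp add: A_def \<alpha>_per)
    moreover have "B (q + (2 * pi * n, 0)) = B q + (2 * pi * n, 0)"
      by (cases q) (simp add: B_def \<beta>_per)
    ultimately show ?thesis by (metis \<Phi>A p)
  qed
  moreover have "\<Phi> p = p" if "\<bar>snd p\<bar> \<ge> 1/4" for p
    using \<Phi>A[of p] that by (cases p) (simp add: A_def B_def \<alpha>_out \<beta>_out)
  \<comment> \<open>At \<open>J = 0\<close> the averaging interval has length zero:
    \<open>w 0 = 0\<close> gives \<open>\<alpha> t 0 = 0\<close>, and \<open>w' 0 = 1\<close> then
    gives \<open>\<beta> 0 t = F t\<close>.\<close>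
  moreover have "\<Phi> (t, 0) = (F t, 0)" for t
    using \<Phi>A[of "(t, 0)"] by (simp add: A_def B_def \<alpha>_def \<beta>_def w0)
  moreover have "Ck_open k UNIV (inv \<Phi>)"
    unfolding inv\<Phi> by (intro Ck_open_compose[OF _ _ _ CA] CinvB) auto
  ultimately show ?thesis using that bij\<Phi> C\<Phi> by blast
qed

section \<open>Descent to the plane\<close>

text \<open>The second coordinate is \<open>(r\<^sup>2 - 1) / 2\<close>, so the radius is
  \<open>sqrt (1 + 2 * snd p)\<close>. The unit circle is the line \<open>snd p = 0\<close>, and the
  half-plane \<open>strip\<close> below covers the punctured plane.\<close>

definition polar :: "plane \<Rightarrow> plane" where
  "polar p = (sqrt (1 + 2 * snd p) * cos (fst p), sqrt (1 + 2 * snd p) * sin (fst p))"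

definition action :: "plane \<Rightarrow> real" where
  "action z = ((fst z)\<^sup>2 + (snd z)\<^sup>2 - 1) / 2"

abbreviation strip :: "plane set" where
  "strip \<equiv> {p. snd p > - 1/2}"

text \<open>The data needed for descent: equivariance makes the image independent of the lift, the
  identity near the lower edge of \<open>strip\<close> allows extension over the origin, and
  injectivity keeps \<open>strip\<close> invariant.\<close>

definition cylinder_map :: "(plane \<Rightarrow> plane) \<Rightarrow> bool" where
  "cylinder_map Q \<longleftrightarrow> inj Q \<and> (\<forall>p (n::int). Q (p + (2 * pi * n, 0)) = Q p + (2 * pi * n, 0)) \<and>
     (\<forall>p. \<bar>snd p\<bar> \<ge> 1/4 \<longrightarrow> Q p = p)"

text \<open>The choice of \<open>p\<close> is immaterial for a cylinder map, because two choices differ by a deck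
  transformation.\<close>

definition descend :: "(plane \<Rightarrow> plane) \<Rightarrow> plane \<Rightarrow> plane" where
  "descend Q z = (if z = 0 then 0 else polar (Q (SOME p. p \<in> strip \<and> polar p = z)))"

lemma open_strip: "open strip"
  by (intro open_Collect_less continuous_intros)

lemma cylinder_map_translate:
  "cylinder_map Q \<Longrightarrow> Q (p + (2 * pi * of_int n, 0)) = Q p + (2 * pi * of_int n, 0)"
  unfolding cylinder_map_def by blast

lemma cylinder_map_outer: "cylinder_map Q \<Longrightarrow> \<bar>snd p\<bar> \<ge> 1/4 \<Longrightarrow> Q p = p"
  unfolding cylinder_map_def by blast

text \<open>A value outside the strip would be a fixed point of \<open>Q\<close>, so by injectivity
  it would equal \<open>p\<close>.\<close>

lemma cylinder_map_strip:
  assumes "cylinder_map Q" "p \<in> strip"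
  shows "Q p \<in> strip"
proof (rule ccontr)
  assume "Q p \<notin> strip"
  then have "\<bar>snd (Q p)\<bar> \<ge> 1/4" by simp
  then have "Q (Q p) = Q p" by (rule cylinder_map_outer[OF assms(1)])
  then have "Q p = p" using assms(1) unfolding cylinder_map_def by (blast dest: injD)
  then show False using assms(2) \<open>Q p \<notin> strip\<close> by simp
qed

lemma action_polar:
  assumes "p \<in> strip"
  shows "action (polar p) = snd p"
proof -
  have "action (polar p) = ((sqrt (1 + 2 * snd p))\<^sup>2 * ((sin (fst p))\<^sup>2 + (cos (fst p))\<^sup>2) - 1) / 2"
    unfolding action_def polar_def by (simp only: fst_conv snd_conv power_mult_distrib) algebra
  then show ?thesis using assms by simp
qed

lemma polar_neq_0:
  assumes "p \<in> strip"
  shows "polar p \<noteq> 0"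
proof
  assume "polar p = 0"
  then have "action (polar p) = - 1/2" by (simp add: action_def)
  then show False using assms by (simp add: action_polar)
qed

lemma polar_translate: "polar (p + (2 * pi * of_int n, 0)) = polar p"
  using sin_cos_eq_iff[of "fst p + 2 * pi * n" "fst p"] by (auto simp: polar_def)

lemma polar_eq_imp_translate:
  assumes "p \<in> strip" "q \<in> strip" "polar p = polar q"
  shows "\<exists>n::int. p = q + (2 * pi * n, 0)"
proof -
  have J: "snd p = snd q" using assms action_polar by metis
  have "sqrt (1 + 2 * snd q) \<noteq> 0" using assms(2) by simp
  then have "sin (fst p) = sin (fst q) \<and> cos (fst p) = cos (fst q)"
    using assms(3) J by (simp add: polar_def)
  then show ?thesis unfolding sin_cos_eq_iff using J by (auto simp: prod_eq_iff)
qed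

text \<open>A local branch of the inverse of \<open>polar\<close> on the open half-plane around
  \<open>z\<close>. In the frame rotated by the angle \<open>\<theta>\<close> of \<open>z\<close>,
  with coordinates \<open>u\<close> and \<open>v\<close>, the relative angle is
  \<open>arctan (v / u)\<close>, which has no branch cut where \<open>u > 0\<close>.\<close>

lemma polar_section:
  assumes "z \<noteq> 0"
  obtains U s where "open U" "z \<in> U" "\<And>n. Ck_open n U s" "s ` U \<subseteq> strip"
    "\<And>y. y \<in> U \<Longrightarrow> polar (s y) = y"
proof -
  obtain a b where z: "z = (a, b)" by (cases z)
  define r where "r = sqrt (a\<^sup>2 + b\<^sup>2)"
  have r2: "r\<^sup>2 = a\<^sup>2 + b\<^sup>2" and r: "r > 0"
    using assms z by (auto simp: r_def sum_power2_gt_zero_iff zero_prod_def)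
  have "(a / r)\<^sup>2 + (b / r)\<^sup>2 = r\<^sup>2 / r\<^sup>2"
    by (simp only: power_divide r2 add_divide_distrib)
  then have "(a / r)\<^sup>2 + (b / r)\<^sup>2 = 1" using r by simp
  then obtain \<theta> where \<theta>: "a / r = cos \<theta>" "b / r = sin \<theta>"
    using sincos_total_2pi by metis
  define u where "u y = fst y * cos \<theta> + snd y * sin \<theta>" for y :: plane
  define v where "v y = snd y * cos \<theta> - fst y * sin \<theta>" for y :: plane
  define s where "s y = (\<theta> + arctan (v y / u y), (fst y * fst y + snd y * snd y - 1) * (1/2))" for y
  define U where "U = {y. 0 < u y}"
  have opn: "open U"
    unfolding U_def u_def by (intro open_Collect_less continuous_intros)
  have ab: "a = r * cos \<theta>" "b = r * sin \<theta>" using \<theta> r by (simp_all add: field_simps)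
  have "u z = r * ((sin \<theta>)\<^sup>2 + (cos \<theta>)\<^sup>2)"
    unfolding z u_def ab fst_conv snd_conv by algebra
  then have "z \<in> U" using r by (simp add: U_def)
  have C: "Ck_open n U s" for n
    unfolding s_def v_def u_def
    by (intro Ck_open_Pair Ck_open_add Ck_open_diff Ck_open_mult Ck_open_const Ck_open_fst
        Ck_open_snd Ck_open_ident Ck_open_divide opn Ck_open_compose[OF _ _ _ Ck_open_arctan])
      (auto simp: U_def u_def)
  have uv: "(u y)\<^sup>2 + (v y)\<^sup>2 = fst y * fst y + snd y * snd y" for y
  proof -
    have "(u y)\<^sup>2 + (v y)\<^sup>2 = (fst y * fst y + snd y * snd y) * ((sin \<theta>)\<^sup>2 + (cos \<theta>)\<^sup>2)"
      unfolding u_def v_def by algebra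
    then show ?thesis by simp
  qed
  have strip: "s y \<in> strip" if "y \<in> U" for y
  proof -
    have "0 < (u y)\<^sup>2 + (v y)\<^sup>2" using that by (simp add: U_def sum_power2_gt_zero_iff)
    then show ?thesis unfolding uv by (simp add: s_def)
  qed
  have "polar (s y) = y" if "y \<in> U" for y
  proof -
    have u: "u y > 0" using that by (simp add: U_def)
    define R where "R = sqrt ((u y)\<^sup>2 + (v y)\<^sup>2)"
    have R: "R > 0" using u by (simp add: R_def sum_power2_gt_zero_iff)
    have "sqrt (1 + (v y / u y)\<^sup>2) = R / u y"
    proof -
      have "1 + (v y / u y)\<^sup>2 = ((u y)\<^sup>2 + (v y)\<^sup>2) / (u y)\<^sup>2"
        using u by (simp add: power_divide add_divide_distrib)
      then show ?thesis using u by (simp add: R_def real_sqrt_divide)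
    qed
    then have cs: "R * cos (arctan (v y / u y)) = u y" "R * sin (arctan (v y / u y)) = v y"
      using u R by (simp_all add: cos_arctan sin_arctan)
    have "sqrt (1 + 2 * snd (s y)) = R"
      unfolding R_def uv by (simp add: s_def field_simps)
    then have "polar (s y) = (R * cos (arctan (v y / u y)) * cos \<theta> - R * sin (arctan (v y / u y)) * sin \<theta>,
        R * cos (arctan (v y / u y)) * sin \<theta> + R * sin (arctan (v y / u y)) * cos \<theta>)"
      by (simp add: polar_def s_def cos_add sin_add algebra_simps)
    also have "\<dots> = (u y * cos \<theta> - v y * sin \<theta>, u y * sin \<theta> + v y * cos \<theta>)"
      unfolding cs ..
    also have "\<dots> = (fst y * ((sin \<theta>)\<^sup>2 + (cos \<theta>)\<^sup>2), snd y * ((sin \<theta>)\<^sup>2 + (cos \<theta>)\<^sup>2))"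
      unfolding u_def v_def prod.inject by (intro conjI; algebra)
    finally show ?thesis by simp
  qed
  then show ?thesis using that opn \<open>z \<in> U\<close> C strip by blast
qed

lemma polar_surj:
  assumes "z \<noteq> 0"
  obtains p where "p \<in> strip" "polar p = z"
  using polar_section[OF assms] by (metis image_subset_iff)

section \<open>Regularity and area preservation of the descended map\<close>

lemma descend_polar:
  assumes "cylinder_map Q" "p \<in> strip"
  shows "descend Q (polar p) = polar (Q p)"
proof -
  define q where "q = (SOME q. q \<in> strip \<and> polar q = polar p)"
  have "q \<in> strip \<and> polar q = polar p"
    unfolding q_def by (rule someI_ex) (use assms(2) in blast)
  then obtain n :: int where "q = p + (2 * pi * n, 0)"
    using polar_eq_imp_translate assms(2) by blast
  then have "polar (Q q) = polar (Q p)"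
    by (simp only: cylinder_map_translate[OF assms(1)] polar_translate)
  then show ?thesis using polar_neq_0[OF assms(2)] by (simp add: descend_def q_def)
qed

lemma descend_inner:
  assumes "cylinder_map Q" "action z < - 1/4"
  shows "descend Q z = z"
proof (cases "z = 0")
  case False
  then obtain p where p: "p \<in> strip" "polar p = z" using polar_surj by blast
  then have "Q p = p" using assms(2) action_polar[OF p(1)] by (intro cylinder_map_outer[OF assms(1)]) simp
  then show ?thesis using descend_polar[OF assms(1) p(1)] p by simp
qed (simp add: descend_def)

lemma descend_compose_eq:
  assumes "cylinder_map Q" "cylinder_map R" "\<And>p. Q (R p) = p"
  shows "descend Q (descend R z) = z"
proof (cases "z = 0")
  case False
  then obtain p where p: "p \<in> strip" "polar p = z" using polar_surj by blast
  then show ?thesis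
    using descend_polar[OF assms(2) p(1)] descend_polar[OF assms(1) cylinder_map_strip[OF assms(2) p(1)]]
      assms(3) by simp
qed (simp add: descend_def)

lemma Ck_open_polar: "Ck_open n strip polar"
  unfolding polar_def
  by (intro Ck_open_Pair Ck_open_mult Ck_open_add Ck_open_const Ck_open_fst Ck_open_snd Ck_open_ident
      Ck_open_compose[OF _ _ _ Ck_open_sqrt] Ck_open_compose[OF _ _ _ Ck_open_sin_cos(1)]
      Ck_open_compose[OF _ _ _ Ck_open_sin_cos(2)] open_strip) auto

lemma open_inner: "open {z. action z < - 1/4}"
  unfolding action_def by (intro open_Collect_less continuous_intros) auto

text \<open>Near the origin, where polar coordinates degenerate, the map is the identity. Elsewhere
  it is locally \<open>polar\<close> after \<open>Q\<close> after a section of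
  \<open>polar\<close>.\<close>

lemma Ck_open_descend:
  assumes "cylinder_map Q" "Ck_open n UNIV Q"
  shows "Ck_open n UNIV (descend Q)"
proof (rule Ck_open_locally)
  fix z
  show "\<exists>V. open V \<and> z \<in> V \<and> Ck_open n V (descend Q)"
  proof (cases "z = 0")
    case True
    have "Ck_open n {z. action z < - 1/4} (descend Q)"
      by (rule Ck_open_cong[OF open_inner _ Ck_open_ident[OF open_inner]])
        (simp add: descend_inner[OF assms(1)])
    moreover have "z \<in> {z. action z < - 1/4}" using True by (simp add: action_def)
    ultimately show ?thesis using open_inner by blast
  next
    case False
    then obtain U s where U: "open U" "z \<in> U" "\<And>n. Ck_open n U s" "s ` U \<subseteq> strip"
      "\<And>y. y \<in> U \<Longrightarrow> polar (s y) = y"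
      using polar_section by blast
    have "Ck_open n U (\<lambda>y. polar (Q (s y)))"
    proof (intro Ck_open_compose[OF _ open_strip _ Ck_open_polar] Ck_open_compose[OF _ _ _ assms(2)] U)
      show "(\<lambda>y. Q (s y)) ` U \<subseteq> strip" using U(4) cylinder_map_strip[OF assms(1)] by blast
    qed auto
    then have "Ck_open n U (descend Q)"
    proof (rule Ck_open_cong[OF U(1), rotated])
      show "polar (Q (s y)) = descend Q y" if "y \<in> U" for y
        using descend_polar[OF assms(1), of "s y"] U(4,5) that by auto
    qed
    then show ?thesis using U by blast
  qed
qed

text \<open>The coordinates preserve area; the sign is negative because the angle comes before the
  radial coordinate.\<close>

lemma jacobian_polar:
  assumes "p \<in> strip"
  shows "jacobian polar p = - 1"
proof -
  obtain t J where p: "p = (t, J)" by (cases p)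
  define r where "r = sqrt (1 + 2 * J)"
  have r: "r > 0" using assms by (simp add: r_def p)
  have dif: "polar differentiable (at (t, J))"
    using Ck_open_differentiable[OF Ck_open_polar[of 1]] assms p by blast
  have "((\<lambda>t. r * cos t) has_real_derivative - r * sin t) (at t)"
    "((\<lambda>t. r * sin t) has_real_derivative r * cos t) (at t)"
    by (auto intro!: derivative_eq_intros)
  then have "((\<lambda>t. polar (t, J)) has_vector_derivative (- r * sin t, r * cos t)) (at t)"
    unfolding polar_def fst_conv snd_conv r_def[symmetric]
    by (intro has_vector_derivative_Pair) (simp_all add: has_real_derivative_iff_has_vector_derivative)
  then have 1: "frechet_derivative polar (at (t, J)) (1, 0) = (- r * sin t, r * cos t)"
    by (rule frechet_derivative_fst_direction[OF dif])
  have "((\<lambda>J. sqrt (1 + 2 * J)) has_real_derivative inverse r) (at J)"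
    using r by (auto intro!: derivative_eq_intros simp: r_def)
  then have "((\<lambda>J. sqrt (1 + 2 * J) * c) has_real_derivative inverse r * c) (at J)" for c
    by (rule DERIV_cmult_right)
  then have "((\<lambda>J. polar (t, J)) has_vector_derivative (inverse r * cos t, inverse r * sin t)) (at J)"
    unfolding polar_def fst_conv snd_conv
    by (intro has_vector_derivative_Pair) (simp_all add: has_real_derivative_iff_has_vector_derivative)
  then have 2: "frechet_derivative polar (at (t, J)) (0, 1) = (inverse r * cos t, inverse r * sin t)"
    by (rule frechet_derivative_snd_direction[OF dif])
  have "jacobian polar p = - (r * inverse r) * ((sin t)\<^sup>2 + (cos t)\<^sup>2)"
    unfolding jac_def p 1 2 fst_conv snd_conv by algebra
  then show ?thesis using r by simp
qed

text \<open>Apply the chain rule to both sides of \<open>descend Q (polar p) = polar (Q p)\<close>: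
  the factors -1 of \<open>polar\<close> at \<open>p\<close> and at \<open>Q p\<close>
  cancel.\<close>

lemma jacobian_descend:
  assumes Q: "cylinder_map Q" "Ck_open k UNIV Q" and k: "1 \<le> k" and jac: "\<And>p. jacobian Q p = 1"
  shows "jacobian (descend Q) z = 1"
proof (cases "z = 0")
  case True
  have "frechet_derivative (descend Q) (at z) = frechet_derivative (\<lambda>x. x) (at z)"
    by (rule frechet_derivative_cong[OF _ open_inner])
      (use True in \<open>auto simp: action_def descend_inner[OF Q(1), unfolded action_def]\<close>)
  then show ?thesis by (simp add: jac_def frechet_derivative_ident)
next
  case False
  then obtain p where p: "p \<in> strip" "polar p = z" using polar_surj by blast
  have dif: "polar differentiable (at q)" if "q \<in> strip" for q
    using Ck_open_differentiable[OF Ck_open_polar[of 1]] that by blast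
  have difQ: "Q differentiable (at q)" "descend Q differentiable (at q)" for q
    using Ck_open_differentiable[OF _ k] Q Ck_open_descend[OF Q] by blast+
  have Qp: "Q p \<in> strip" using cylinder_map_strip[OF Q(1) p(1)] .
  have "(\<lambda>p. descend Q (polar p)) differentiable (at p)"
    using differentiable_chain_at[OF dif[OF p(1)] difQ(2)] by (simp add: comp_def)
  then have "jacobian (\<lambda>p. polar (Q p)) p = jacobian (\<lambda>p. descend Q (polar p)) p"
    by (subst frechet_derivative_cong[OF _ open_strip p(1)]) (auto simp: descend_polar[OF Q(1)])
  then have "jacobian polar (Q p) * jacobian Q p = jacobian (descend Q) z * jacobian polar p"
    by (simp only: jacobian_compose[OF difQ(1) dif[OF Qp]] jacobian_compose[OF dif[OF p(1)] difQ(2)] p(2))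
  then show ?thesis by (simp add: jacobian_polar[OF p(1)] jacobian_polar[OF Qp] jac)
qed

lemma Ck_on_UNIV_if_Ck_open: "Ck_open k UNIV f \<Longrightarrow> Ck_on k UNIV f"
  unfolding Ck_on_def by blast

theorem theorem3:
  fixes k :: nat and f :: "real \<times> real \<Rightarrow> real \<times> real"
  assumes "k \<ge> 1"
    and "Ck_diffeo k unit_circle unit_circle f"
    and "circle_orientation_preserving f"
  shows "\<exists>\<phi> :: real \<times> real \<Rightarrow> real \<times> real.
           Ck_symplectomorphism k \<phi> \<and> (\<forall>z\<in>unit_circle. \<phi> z = f z)"
proof -
  obtain F F' where F: "\<And>t. (F has_real_derivative F' t) (at t)" "\<And>t. F' t > 0"
    "continuous_on UNIV F'" "Ck_open k UNIV F" "\<And>t (n::int). F (t + 2 * pi * n) = F t + 2 * pi * n"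
    and fF: "\<And>t. f (cos t, sin t) = (cos (F t), sin (F t))"
    using circle_diffeo_lift[OF assms] by metis
  obtain \<Phi> where \<Phi>: "bij \<Phi>" "Ck_open k UNIV \<Phi>" "Ck_open k UNIV (inv \<Phi>)" "\<And>p. jacobian \<Phi> p = 1"
    "\<And>p (n::int). \<Phi> (p + (2 * pi * n, 0)) = \<Phi> p + (2 * pi * n, 0)"
    "\<And>p. \<bar>snd p\<bar> \<ge> 1/4 \<Longrightarrow> \<Phi> p = p" "\<And>t. \<Phi> (t, 0) = (F t, 0)"
    using cylinder_map_exists[OF assms(1) F] by metis
  have inv: "inv \<Phi> (\<Phi> p) = p" "\<Phi> (inv \<Phi> p) = p" for p
    using \<Phi>(1) by (auto simp: bij_def surj_f_inv_f)
  have cyl: "cylinder_map \<Phi>"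
    unfolding cylinder_map_def using \<Phi> by (simp add: bij_is_inj)
  have cyl': "cylinder_map (inv \<Phi>)"
    unfolding cylinder_map_def
    using \<Phi>(5,6) bij_is_inj[OF bij_imp_bij_inv[OF \<Phi>(1)]] by (metis inv)
  define \<phi> where "\<phi> = descend \<Phi>"
  define \<psi> where "\<psi> = descend (inv \<Phi>)"
  \<comment> \<open>Descent respects composition, so the descended inverse is the inverse of the
    descended map.\<close>
  have "\<phi> \<circ> \<psi> = id" "\<psi> \<circ> \<phi> = id"
    by (auto simp: \<phi>_def \<psi>_def inv descend_compose_eq[OF cyl cyl'] descend_compose_eq[OF cyl' cyl])
  then have bij: "bij \<phi>" and inv\<phi>: "inv \<phi> = \<psi>"
    by (auto intro: o_bij inv_unique_comp)
  have C: "Ck_open k UNIV \<phi>" "Ck_open k UNIV \<psi>"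
    unfolding \<phi>_def \<psi>_def using Ck_open_descend cyl cyl' \<Phi>(2,3) by blast+
  have "pullback \<phi> dx_wedge_dy p u v = dx_wedge_dy p u v" for p u v
    using dx_wedge_dy_linear[OF linear_frechet_derivative[OF Ck_open_differentiable[OF C(1) assms(1) UNIV_I]]]
      jacobian_descend[OF cyl \<Phi>(2) assms(1) \<Phi>(4)]
    unfolding pullback_def \<phi>_def by simp
  then have "pullback \<phi> dx_wedge_dy = dx_wedge_dy" by blast
  then have "Ck_symplectomorphism k \<phi>"
    unfolding Ck_symplectomorphism_def Ck_diffeo_def
    using bij C by (auto simp: inv\<phi> Ck_on_UNIV_if_Ck_open)
  moreover have "\<phi> z = f z" if "z \<in> unit_circle" for z
  proof -
    have "(fst z)\<^sup>2 + (snd z)\<^sup>2 = 1" using that by (cases z) (simp add: norm_Pair)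
    then obtain t where z: "z = (cos t, sin t)"
      using sincos_total_2pi by (metis prod.collapse)
    \<comment> \<open>The circle is the image of the line \<open>J = 0\<close>, on which
      \<open>\<Phi>\<close> acts by the lift \<open>F\<close>.\<close>
    then have "\<phi> z = descend \<Phi> (polar (t, 0))" by (simp add: \<phi>_def polar_def)
    also have "\<dots> = polar (\<Phi> (t, 0))" by (rule descend_polar[OF cyl]) simp
    also have "\<dots> = f z" by (simp add: \<Phi>(7) polar_def z fF)
    finally show ?thesis .
  qed
  ultimately show ?thesis by blast
qed

end
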